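(* Let $A\in\mathbb{R}_+^{n\times n}$ be irreducible with degree of cyclicity $h$, let $b\in\mathbb{R}_+^n$ with $\operatorname{rank}([b\ Ab\ \dots\ A^{n-1}b])=n$, let $p_1,\dots,p_m\in\mathbb{R}_+^n$, let $N$ be a positive integer, and set $$M_f=[b,\dots,A^{N-1}b],\qquad M_\infty=[b,\dots,A^{N-1}b,v_{f,0},\dots,v_{f,h-1}].$$ For a matrix $M\in\{M_f,M_\infty\}$ with $L$ columns and each $i\in\{1,\dots,m\}$, consider the linear program $$\min_{x_i\in\mathbb{R}^L}\ x_i^{T}\mathbf{1}\quad\text{subject to}\quad Mx_i=p_i,\ x_i\ge0,$$ where $\mathbf{1}\in\mathbb{R}^L$ is the vector of ones. Then for each $i\in\{1,\dots,m\}$: (a) Suppose $\mathrm{Conset}_\infty(A,b)$ is polyhedral and $N\ge k_{\mathrm{vert}}^\infty$. The linear program with $M=M_\infty$ has an optimal solution $x_i^*\in\mathbb{R}_+^{N+h}$ if and only if there exists $z\in\mathbb{R}_+^{N+h}$ with $M_\infty z=p_i$. (b) Suppose $\mathrm{Conset}_{\mathrm f}(A,b)$ is polyhedral and $N\ge k_{\mathrm{vert}}$. The linear program with $M=M_f$ has an optimal solution $x_i^*\in\mathbb{R}_+^{N}$ if and only if there exists $z\in\mathbb{R}_+^{N}$ with $M_f z=p_i$.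
   Context: $\mathbb{R}_+=[0,\infty)$; $\mathrm{cone}(\cdot)$ denotes all finite nonnegative linear combinations; a cone is polyhedral if finitely generated. A matrix $A\in\mathbb{R}_+^{n\times n}$ is irreducible if no simultaneous permutation of rows and columns brings it to block lower triangular form with square nonempty diagonal blocks (a $1\times1$ matrix is regarded as irreducible exactly when its entry is strictly positive). An irreducible $A$ has degree of cyclicity $h$ if its eigenvalues of modulus $\rho(A)$ (the spectral radius) are simple and are exactly $\rho(A)e^{2\pi ik/h}$, $k=0,\dots,h-1$. Then, after a permutation of coordinates, $A^h$ is block diagonal with $h$ primitive diagonal blocks, each with Perron root $\rho(A)^h$; $v_{f,0},\dots,v_{f,h-1}$ are the corresponding $h$ distinct nonnegative eigenvectors of $A^h$ for the eigenvalue $\rho(A)^h$, each equal to the Perron eigenvector of one block extended by zero (unique up to positive scaling). Also $A_{f,i}=\lim_{k\to\infty}\frac{A^{kh}}{\rho(A)^{kh}}A^i$, $i=0,\dots,h-1$. For the system $x(t+1)=Ax(t)+bu(t)$, $x(0)=0$, with scalar inputs $u(t)\ge0$: $\mathrm{Conset}_k(A,b)=\mathrm{cone}(b,Ab,\dots,A^{k-1}b)$ is the set of states reachable at time $k$; $\mathrm{Conset}_{\mathrm f}(A,b)=\bigcup_{k\ge1}\mathrm{Conset}_k(A,b)$; $\mathrm{Conset}_\infty(A,b)$ is its Euclidean closure. When the respective cone is polyhedral, $k_{\mathrm{vert}}$ is the smallest positive integer $k$ with $A^kb\in\mathrm{Conset}_k(A,b)$, and $k_{\mathrm{vert}}^\infty$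 is the smallest positive integer $k$ with $A^kb\in\mathrm{cone}(b,\dots,A^{k-1}b,A_{f,0}b,\dots,A_{f,h-1}b)$. *)

theory Defs
  imports
    "Jordan_Normal_Form.Spectral_Radius"
    "Jordan_Normal_Form.DL_Rank"
begin

abbreviation spec_rad :: "real mat \<Rightarrow> real" where
  "spec_rad A \<equiv> spectral_radius (map_mat complex_of_real A)"

text \<open>For \<open>\<sigma>\<close> permuting the indices, these are the simultaneous permutation of rows and
  columns of \<open>A\<close>, and the corresponding permutation of the coordinates of \<open>v\<close>.\<close>

definition perm_mat :: "(nat \<Rightarrow> nat) \<Rightarrow> 'a mat \<Rightarrow> 'a mat" where
  "perm_mat \<sigma> A = mat (dim_row A) (dim_col A) (\<lambda>(r, c). A $$ (\<sigma> r, \<sigma> c))"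

definition perm_vec :: "(nat \<Rightarrow> nat) \<Rightarrow> 'a vec \<Rightarrow> 'a vec" where
  "perm_vec \<sigma> v = vec (dim_vec v) (\<lambda>r. v $ \<sigma> r)"

text \<open>Two diagonal blocks suffice, since in a block lower triangular form with more of them
  all but the first can be merged. The order on matrices is entrywise.\<close>

definition irreducible_mat :: "real mat \<Rightarrow> bool" where
  "irreducible_mat A \<longleftrightarrow> (let n = dim_row A in
     A \<in> carrier_mat n n \<and> 0 < n \<and> 0\<^sub>m n n \<le> A \<and>
     (if n = 1 then 0 < A $$ (0, 0)
      else \<not> (\<exists>\<sigma> k B C D. \<sigma> permutes {0..<n} \<and> 0 < k \<and> k < n \<and>
             B \<in> carrier_mat k k \<and> C \<in> carrier_mat (n - k) k \<and>
             D \<in> carrier_mat (n - k) (n - k) \<and>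
             perm_mat \<sigma> A = four_block_mat B (0\<^sub>m k (n - k)) C D)))"

definition cyclicity :: "real mat \<Rightarrow> nat \<Rightarrow> bool" where
  "cyclicity A h \<longleftrightarrow> 0 < h \<and>
     {l. eigenvalue (map_mat complex_of_real A) l \<and> cmod l = spec_rad A}
       = (\<lambda>k. complex_of_real (spec_rad A) * cis (2 * pi * real k / real h)) ` {0..<h} \<and>
     (\<forall>l. eigenvalue (map_mat complex_of_real A) l \<and> cmod l = spec_rad A \<longrightarrow>
        Polynomial.order l (char_poly (map_mat complex_of_real A)) = 1)"

definition primitive_mat :: "real mat \<Rightarrow> bool" where
  "primitive_mat B \<longleftrightarrow> irreducible_mat B \<and> cyclicity B 1"

definition perron_eigenvector :: "real mat \<Rightarrow> real vec \<Rightarrow> bool" where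
  "perron_eigenvector B w \<longleftrightarrow> eigenvector B w (spec_rad B) \<and> (\<forall>r<dim_row B. 0 < w $ r)"

text \<open>The vector \<open>w\<close>, living on block \<open>j\<close> of \<open>diag_block_mat Bs\<close>, extended by zero.\<close>

definition extend_by_zero :: "real mat list \<Rightarrow> nat \<Rightarrow> real vec \<Rightarrow> real vec" where
  "extend_by_zero Bs j w =
     0\<^sub>v (sum_list (map dim_row (take j Bs))) @\<^sub>v w @\<^sub>v
     0\<^sub>v (sum_list (map dim_row (drop (Suc j) Bs)))"

text \<open>\<open>vs\<close> is an admissible choice of \<open>v\<^bsub>f,0\<^esub>, \<dots>, v\<^bsub>f,h-1\<^esub>\<close>. These vectors are determined only
  up to their numbering and positive scaling, hence a predicate. Using the block number
  \<open>j\<close> as index gives one vector per block and makes them distinct.\<close>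

definition block_perron_vectors :: "real mat \<Rightarrow> nat \<Rightarrow> real vec list \<Rightarrow> bool" where
  "block_perron_vectors A h vs \<longleftrightarrow> length vs = h \<and>
     (\<exists>\<sigma> Bs. \<sigma> permutes {0..<dim_row A} \<and> length Bs = h \<and>
        perm_mat \<sigma> (A ^\<^sub>m h) = diag_block_mat Bs \<and>
        (\<forall>j<h. primitive_mat (Bs ! j) \<and> spec_rad (Bs ! j) = spec_rad A ^ h \<and>
           0\<^sub>v (dim_row A) \<le> vs ! j \<and> eigenvector (A ^\<^sub>m h) (vs ! j) (spec_rad A ^ h) \<and>
           (\<exists>w. perron_eigenvector (Bs ! j) w \<and>
                perm_vec \<sigma> (vs ! j) = extend_by_zero Bs j w)))"

definition cone_of :: "nat \<Rightarrow> real vec set \<Rightarrow> real vec set" where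
  "cone_of n S = {mat_of_cols n us *\<^sub>v c | us c.
     set us \<subseteq> S \<and> c \<in> carrier_vec (length us) \<and> 0\<^sub>v (length us) \<le> c}"

definition polyhedral_cone :: "nat \<Rightarrow> real vec set \<Rightarrow> bool" where
  "polyhedral_cone n C \<longleftrightarrow> (\<exists>S. finite S \<and> S \<subseteq> carrier_vec n \<and> C = cone_of n S)"

definition euclidean_closure :: "nat \<Rightarrow> real vec set \<Rightarrow> real vec set" where
  "euclidean_closure n C =
     {x \<in> carrier_vec n. \<forall>e>0. \<exists>y\<in>C. sqrt ((x - y) \<bullet> (x - y)) < e}"

definition krylov :: "real mat \<Rightarrow> real vec \<Rightarrow> nat \<Rightarrow> real vec list" where
  "krylov A b k = map (\<lambda>t. (A ^\<^sub>m t) *\<^sub>v b) [0..<k]"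

definition conset :: "real mat \<Rightarrow> real vec \<Rightarrow> nat \<Rightarrow> real vec set" where
  "conset A b k = cone_of (dim_vec b) (set (krylov A b k))"

definition conset_f :: "real mat \<Rightarrow> real vec \<Rightarrow> real vec set" where
  "conset_f A b = (\<Union>k\<in>{1..}. conset A b k)"

definition conset_inf :: "real mat \<Rightarrow> real vec \<Rightarrow> real vec set" where
  "conset_inf A b = euclidean_closure (dim_vec b) (conset_f A b)"

definition A_f :: "real mat \<Rightarrow> nat \<Rightarrow> nat \<Rightarrow> real mat" where
  "A_f A h i = mat (dim_row A) (dim_row A) (\<lambda>(r, c).
     lim (\<lambda>k. (((1 / spec_rad A ^ (k * h)) \<cdot>\<^sub>m (A ^\<^sub>m (k * h))) * (A ^\<^sub>m i)) $$ (r, c)))"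

text \<open>The following two are meaningful only when the respective cone is polyhedral.\<close>

definition k_vert :: "real mat \<Rightarrow> real vec \<Rightarrow> nat" where
  "k_vert A b = (LEAST k. 0 < k \<and> (A ^\<^sub>m k) *\<^sub>v b \<in> conset A b k)"

definition k_vert_inf :: "real mat \<Rightarrow> nat \<Rightarrow> real vec \<Rightarrow> nat" where
  "k_vert_inf A h b = (LEAST k. 0 < k \<and>
     (A ^\<^sub>m k) *\<^sub>v b \<in>
       cone_of (dim_vec b) (set (krylov A b k) \<union> (\<lambda>i. A_f A h i *\<^sub>v b) ` {0..<h}))"

definition M_f :: "real mat \<Rightarrow> real vec \<Rightarrow> nat \<Rightarrow> real mat" where
  "M_f A b N = mat_of_cols (dim_vec b) (krylov A b N)"

definition M_inf :: "real mat \<Rightarrow> real vec \<Rightarrow> nat \<Rightarrow> real vec list \<Rightarrow> real mat" where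
  "M_inf A b N vs = mat_of_cols (dim_vec b) (krylov A b N @ vs)"

definition lp_feasible :: "real mat \<Rightarrow> real vec \<Rightarrow> real vec \<Rightarrow> bool" where
  "lp_feasible M q x \<longleftrightarrow>
     x \<in> carrier_vec (dim_col M) \<and> M *\<^sub>v x = q \<and> 0\<^sub>v (dim_col M) \<le> x"

definition lp_objective :: "real vec \<Rightarrow> real" where
  "lp_objective x = x \<bullet> vec (dim_vec x) (\<lambda>_. 1)"

definition lp_optimal :: "real mat \<Rightarrow> real vec \<Rightarrow> real vec \<Rightarrow> bool" where
  "lp_optimal M q x \<longleftrightarrow> lp_feasible M q x \<and>
     (\<forall>y. lp_feasible M q y \<longrightarrow> lp_objective x \<le> lp_objective y)"

end

theory Submission
  imports Defs "HOL-Analysis.Function_Topology"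
begin

text \<open>On the nonnegative orthant the objective bounds every coordinate, so the feasible points
  whose objective does not exceed that of a given one form a compact set, on which the continuous
  objective attains its minimum.\<close>

lemma lp_objective_eq_sum: "lp_objective x = (\<Sum>i<dim_vec x. vec_index x i)"
  by (simp add: lp_objective_def scalar_prod_def atLeast0LessThan)

text \<open>Spells the constraints out as finitely many scalar equations and weak inequalities, the
  form in which closedness can be read off. Since \<open>q\<close> is arbitrary, equality of vectors
  also contributes the dimension condition on \<open>q\<close>.\<close>

lemma lp_feasible_iff_coordinates:
  "lp_feasible M q x \<longleftrightarrow> dim_vec x = dim_col M \<and> dim_vec q = dim_row M \<and>
     (\<forall>r<dim_row M. (\<Sum>i<dim_col M. M $$ (r, i) * vec_index x i) = vec_index q r) \<and>
     (\<forall>i<dim_col M. 0 \<le> vec_index x i)"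
proof -
  have "M *\<^sub>v x = q \<longleftrightarrow> dim_vec q = dim_row M \<and>
      (\<forall>r<dim_row M. (\<Sum>i<dim_col M. M $$ (r, i) * vec_index x i) = vec_index q r)"
    if "dim_vec x = dim_col M"
  proof -
    have "vec_index (M *\<^sub>v x) r = (\<Sum>i<dim_col M. M $$ (r, i) * vec_index x i)"
      if "r < dim_row M" for r
      using that \<open>dim_vec x = dim_col M\<close>
      by (simp add: scalar_prod_def atLeast0LessThan)
    moreover have "M *\<^sub>v x = q \<longleftrightarrow> dim_row M = dim_vec q \<and>
        (\<forall>r<dim_vec q. vec_index (M *\<^sub>v x) r = vec_index q r)"
      unfolding vec_eq_iff[of "M *\<^sub>v x" q] by (simp only: dim_mult_mat_vec)
    ultimately show ?thesis by metis
  qed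
  moreover have "0\<^sub>v (dim_col M) \<le> x \<longleftrightarrow> (\<forall>i<dim_col M. 0 \<le> vec_index x i)"
    if "dim_vec x = dim_col M"
    using that by (simp add: less_eq_vec_def)
  ultimately show ?thesis
    unfolding lp_feasible_def carrier_vec_def by blast
qed

lemma lp_optimal_exists:
  assumes "lp_feasible M q z"
  shows "\<exists>x. lp_optimal M q x"
proof -
  let ?L = "dim_col M"
  define S where "S = lp_objective z"
  \<comment> \<open>Vectors are encoded as functions on the naturals under the product topology.
    Vanishing from \<open>?L\<close> on keeps the coordinates that no constraint touches
    bounded.\<close>
  define K where "K = {f::nat \<Rightarrow> real. (\<forall>i<?L. 0 \<le> f i) \<and> (\<forall>i\<ge>?L. f i = 0) \<and>
    (\<forall>r<dim_row M. (\<Sum>i<?L. M $$ (r, i) * f i) = vec_index q r) \<and> (\<Sum>i<?L. f i) \<le> S}"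
  have feas: "lp_feasible M q (vec ?L f)" if "f \<in> K" for f
    using that assms by (auto simp: K_def lp_feasible_iff_coordinates)
  have K_of: "(\<lambda>i. if i < ?L then vec_index y i else 0) \<in> K"
    if "lp_feasible M q y" "lp_objective y \<le> S" for y
    using that by (auto simp: K_def lp_feasible_iff_coordinates lp_objective_eq_sum)
  \<comment> \<open>Each condition is an equation or weak inequality between finite linear
    combinations of coordinate projections, which are continuous; index bounds such as
    \<open>i < ?L\<close> do not depend on \<open>f\<close>.\<close>
  have "closed K"
    unfolding K_def
    by (intro closed_Collect_conj closed_Collect_all closed_Collect_imp open_Collect_const
        closed_Collect_le closed_Collect_eq
        continuous_intros continuous_on_product_coordinates)
  moreover have "K \<subseteq> Pi\<^sub>E UNIV (\<lambda>i. {0..S})"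
  proof
    fix f assume f: "f \<in> K"
    then have nonneg: "0 \<le> f i" for i
      by (cases "i < ?L") (auto simp: K_def)
    have sum_le: "(\<Sum>j<?L. f j) \<le> S"
      using f by (simp add: K_def)
    have "f i \<le> S" for i
    proof (cases "i < ?L")
      case True
      then have "f i \<le> (\<Sum>j<?L. f j)"
        by (intro member_le_sum) (auto simp: nonneg)
      with sum_le show ?thesis by simp
    next
      case False
      \<comment> \<open>Here \<open>f i = 0\<close>, so what remains is \<open>0 \<le> S\<close>,
        and the nonnegative sum lies below \<open>S\<close>.\<close>
      have "0 \<le> (\<Sum>j<?L. f j)"
        by (simp add: sum_nonneg nonneg)
      with False f sum_le show ?thesis by (simp add: K_def)
    qed
    with nonneg show "f \<in> Pi\<^sub>E UNIV (\<lambda>i. {0..S})" by auto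
  qed
  \<comment> \<open>Tychonoff's theorem for a product of copies of one compact interval.\<close>
  moreover have "compact (Pi\<^sub>E UNIV (\<lambda>i::nat. {0..S}))"
    using compactin_PiE[of "\<lambda>i::nat. euclidean" UNIV "\<lambda>i. {0..S}"]
    by (simp add: euclidean_product_topology)
  ultimately have "compact K"
    by (metis closed_Int_compact inf.absorb1)
  moreover have "K \<noteq> {}"
    using K_of[OF assms] by (auto simp: S_def)
  moreover have "continuous_on K (\<lambda>f. \<Sum>i<?L. f i)"
    by (intro continuous_on_sum continuous_on_subset[OF continuous_on_product_coordinates] subset_UNIV)
  ultimately obtain f where f: "f \<in> K" and min: "\<And>g. g \<in> K \<Longrightarrow> (\<Sum>i<?L. f i) \<le> (\<Sum>i<?L. g i)"
    using continuous_attains_inf[of K "\<lambda>f. \<Sum>i<?L. f i"] by blast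
  \<comment> \<open>Minimality on \<open>K\<close> extends to all feasible points: one that does not
    give an element of \<open>K\<close> has objective above \<open>S\<close>, while that of
    \<open>f\<close> is at most \<open>S\<close>.\<close>
  have "lp_objective (vec ?L f) \<le> lp_objective y" if y: "lp_feasible M q y" for y
  proof (cases "lp_objective y \<le> S")
    case True
    from min[OF K_of[OF y True]] y show ?thesis
      by (simp add: lp_objective_eq_sum lp_feasible_iff_coordinates)
  next
    case False
    with f show ?thesis by (simp add: K_def lp_objective_eq_sum)
  qed
  with feas[OF f] show ?thesis
    unfolding lp_optimal_def by blast
qed

text \<open>An optimal point is in particular feasible; conversely a feasible point yields an
  optimal one by compactness. Naming the column count \<open>L\<close> lets it be instantiated with
  \<open>N + h\<close> and \<open>N\<close>.\<close>

lemma lp_optimal_ex_iff_feasible: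
  assumes "dim_col M = L"
  shows "(\<exists>x. x \<in> carrier_vec L \<and> 0\<^sub>v L \<le> x \<and> lp_optimal M q x) \<longleftrightarrow>
    (\<exists>z. z \<in> carrier_vec L \<and> 0\<^sub>v L \<le> z \<and> M *\<^sub>v z = q)"
proof -
  have feasible_iff: "lp_feasible M q x \<longleftrightarrow> x \<in> carrier_vec L \<and> 0\<^sub>v L \<le> x \<and> M *\<^sub>v x = q" for x
    unfolding lp_feasible_def assms by (simp only: conj_ac)
  show ?thesis
  proof
    assume "\<exists>x. x \<in> carrier_vec L \<and> 0\<^sub>v L \<le> x \<and> lp_optimal M q x"
    then show "\<exists>z. z \<in> carrier_vec L \<and> 0\<^sub>v L \<le> z \<and> M *\<^sub>v z = q"
      unfolding lp_optimal_def feasible_iff by metis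
  next
    assume "\<exists>z. z \<in> carrier_vec L \<and> 0\<^sub>v L \<le> z \<and> M *\<^sub>v z = q"
    then obtain x where x: "lp_optimal M q x"
      using lp_optimal_exists unfolding feasible_iff[symmetric] by metis
    then have "lp_feasible M q x"
      unfolding lp_optimal_def by (rule conjunct1)
    with x show "\<exists>x. x \<in> carrier_vec L \<and> 0\<^sub>v L \<le> x \<and> lp_optimal M q x"
      unfolding feasible_iff by metis
  qed
qed

theorem proposition6:
  fixes A :: "real mat" and b :: "real vec" and p :: "nat \<Rightarrow> real vec"
    and vs :: "real vec list" and n m N h :: nat
  assumes "A \<in> carrier_mat n n" and "0\<^sub>m n n \<le> A"
    and "irreducible_mat A" and "cyclicity A h"
    and "b \<in> carrier_vec n" and "0\<^sub>v n \<le> b"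
    and "vec_space.rank n (mat_of_cols n (krylov A b n)) = n"
    and "\<forall>i\<in>{1..m}. p i \<in> carrier_vec n \<and> 0\<^sub>v n \<le> p i"
    and "0 < N"
    and "block_perron_vectors A h vs"
  shows "\<forall>i\<in>{1..m}.
    (polyhedral_cone n (conset_inf A b) \<and> k_vert_inf A h b \<le> N \<longrightarrow>
       ((\<exists>x. x \<in> carrier_vec (N + h) \<and> 0\<^sub>v (N + h) \<le> x \<and> lp_optimal (M_inf A b N vs) (p i) x)
        \<longleftrightarrow> (\<exists>z. z \<in> carrier_vec (N + h) \<and> 0\<^sub>v (N + h) \<le> z \<and> M_inf A b N vs *\<^sub>v z = p i))) \<and>
    (polyhedral_cone n (conset_f A b) \<and> k_vert A b \<le> N \<longrightarrow>
       ((\<exists>x. x \<in> carrier_vec N \<and> 0\<^sub>v N \<le> x \<and> lp_optimal (M_f A b N) (p i) x)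
        \<longleftrightarrow> (\<exists>z. z \<in> carrier_vec N \<and> 0\<^sub>v N \<le> z \<and> M_f A b N *\<^sub>v z = p i)))"
proof -
  \<comment> \<open>Both equivalences are instances of the general one once the columns are counted:
    \<open>N\<close> Krylov vectors, followed in \<open>M_inf\<close> by the \<open>h\<close>
    vectors of \<open>vs\<close>.\<close>
  have "dim_col (M_inf A b N vs) = N + h"
    using assms(10) by (simp add: M_inf_def krylov_def block_perron_vectors_def)
  moreover have "dim_col (M_f A b N) = N"
    by (simp add: M_f_def krylov_def)
  ultimately show ?thesis
    by (simp add: lp_optimal_ex_iff_feasible)
qed

end
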